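(* With $c_n$ as defined in the context, $c_2 = \frac12$ and $c_3 = \frac13$.
   Context: For $\beta\in[0,1]$, let $S(\beta)$ be the set of polynomials of degree at least $2$ with complex coefficients, with all roots in the closed unit disk $\{z\in\mathbb{C}: |z|\le 1\}$, and with at least one root at $\beta$. For $P\in S(\beta)$, let $d(P,\beta)$ be the distance between $\beta$ and the closest root of the derivative $P'$, i.e. $d(P,\beta)=\min\{|\zeta-\beta| : P'(\zeta)=0\}$. For an integer $n\ge 2$, let $r_n(\beta)=\sup\{d(P,\beta) : P\in S(\beta),\ \deg P=n\}$. For $0<\beta<1$ let $c_n(\beta)=\dfrac{1-r_n(\beta)}{\beta(1-\beta)}$, and let $c_n=\inf\{c_n(\beta) : 0<\beta<1\}$ (this set is bounded below, so the infimum is a real number). *)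

theory Defs
  imports "HOL-Analysis.Analysis" "HOL-Computational_Algebra.Computational_Algebra"
begin

definition disk_polys :: "real \<Rightarrow> complex poly set" where
  "disk_polys \<beta> = {P. degree P \<ge> 2 \<and> (\<forall>z. poly P z = 0 \<longrightarrow> cmod z \<le> 1)
             \<and> poly P (complex_of_real \<beta>) = 0}"

(* For degree P >= 2 the derivative is a nonconstant complex polynomial, so the set under
   Min is finite and nonempty. *)
definition crit_dist :: "complex poly \<Rightarrow> real \<Rightarrow> real" where
  "crit_dist P \<beta> = Min {cmod (\<zeta> - complex_of_real \<beta>) | \<zeta>. poly (pderiv P) \<zeta> = 0}"

(* For n >= 2 and 0 <= \<beta> <= 1 the set is nonempty and, by Gauss-Lucas, bounded above by 2,
   so the real-valued Sup is the actual supremum. *)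
definition r_sup :: "nat \<Rightarrow> real \<Rightarrow> real" where
  "r_sup n \<beta> = Sup {crit_dist P \<beta> | P. P \<in> disk_polys \<beta> \<and> degree P = n}"

definition c_at :: "nat \<Rightarrow> real \<Rightarrow> real" where
  "c_at n \<beta> = (1 - r_sup n \<beta>) / (\<beta> * (1 - \<beta>))"

definition c_inf :: "nat \<Rightarrow> real" where
  "c_inf n = Inf {c_at n \<beta> | \<beta>. 0 < \<beta> \<and> \<beta> < 1}"

end

theory Submission
  imports Defs
begin

text \<open>
  Both constants come from exact formulas for the extremal radius:
  \<open>r\<^sub>2(\<beta>) = (1 + \<beta>) / 2\<close>, and \<open>r\<^sub>3(\<beta>)\<close> is the positive root \<open>d\<close> of
  \<open>3 d\<^sup>2 - 3 \<beta> d = 1 - \<beta>\<^sup>2\<close>. In both degrees \<open>c\<^sub>n(\<beta>) \<ge> 1 / n\<close> on \<open>(0, 1)\<close>, while \<open>c\<^sub>n(\<beta>)\<close> tends to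
  \<open>1 / n\<close> as \<open>\<beta>\<close> approaches \<open>1\<close>, so the infimum equals this limit.

  In degree 2 the only critical point is the midpoint of the two roots, and the second root can
  be no further from \<open>\<beta>\<close> than \<open>-1\<close>.

  In degree 3, move \<open>\<beta>\<close> to the origin and let \<open>a, b\<close> be the two other roots and \<open>w\<^sub>1, w\<^sub>2\<close> the
  critical points. The reciprocals satisfy \<open>1/a + 1/b = (1/w\<^sub>1 + 1/w\<^sub>2) / 2\<close> and
  \<open>(1/a) (1/b) = (1/w\<^sub>1) (1/w\<^sub>2) / 3\<close>. The parallelogram law turns these two relations into
  \<open>\<bar>1/a\<bar>\<^sup>2 + \<bar>1/b\<bar>\<^sup>2 \<le> (\<bar>1/w\<^sub>1\<bar>\<^sup>2 + \<bar>1/w\<^sub>2\<bar>\<^sup>2) / 3\<close> (lemma \<open>sum_recip_squares_bound\<close>). On the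
  other hand, for \<open>a \<noteq> 0\<close> the root \<open>\<beta> + a\<close> lies in the unit disk exactly when
  \<open>(1 - \<beta>\<^sup>2) \<bar>1/a\<bar>\<^sup>2 - 2 \<beta> Re (1/a) \<ge> 1\<close>, and likewise for \<open>b\<close>. If both critical points are at
  distance at least \<open>d\<close> from the origin, adding the two disk inequalities gives
  \<open>3 d\<^sup>2 - 3 \<beta> d \<le> 1 - \<beta>\<^sup>2\<close> (lemma \<open>cubic_crit_points_bound\<close>). Equality holds for
  \<open>(z - \<beta> + d)\<^sup>3 - d\<^sup>3\<close>, whose critical points coincide and whose two other roots are on the
  unit circle (lemma \<open>cubic_extremal\<close>).
\<close>

section \<open>Extremal radii and the infimum of the quotients\<close>

lemma crit_dist_le:
  assumes "degree P \<ge> 2" "poly (pderiv P) \<zeta> = 0"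
  shows "crit_dist P \<beta> \<le> cmod (\<zeta> - complex_of_real \<beta>)"
proof -
  have "pderiv P \<noteq> 0"
    using assms(1) degree_pderiv[of P] by auto
  then have "finite ((\<lambda>\<zeta>. cmod (\<zeta> - complex_of_real \<beta>)) ` {\<zeta>. poly (pderiv P) \<zeta> = 0})"
    by (intro finite_imageI poly_roots_finite)
  then show ?thesis
    unfolding crit_dist_def using assms(2)
    by (intro Min_le) (auto simp: setcompr_eq_image)
qed

lemma crit_dist_unique:
  assumes "\<And>\<zeta>. poly (pderiv P) \<zeta> = 0 \<longleftrightarrow> \<zeta> = \<zeta>0"
  shows "crit_dist P \<beta> = cmod (\<zeta>0 - complex_of_real \<beta>)"
  unfolding crit_dist_def by (simp add: assms)

lemma r_sup_eq_maximum:
  assumes "P0 \<in> disk_polys \<beta>" "degree P0 = n" "crit_dist P0 \<beta> = r"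
    and "\<And>P. P \<in> disk_polys \<beta> \<Longrightarrow> degree P = n \<Longrightarrow> crit_dist P \<beta> \<le> r"
  shows "r_sup n \<beta> = r"
  unfolding r_sup_def using assms by (intro cSup_eq_maximum) auto

text \<open>
  A lower bound for all quotients that is also their limit at the right end of the interval is
  their infimum. An upper estimate \<open>h\<close> with that limit suffices, so the quotient itself never has
  to be expanded around \<open>\<beta> = 1\<close>.
\<close>

lemma c_inf_eq_limit:
  assumes "\<And>\<beta>. 0 < \<beta> \<Longrightarrow> \<beta> < 1 \<Longrightarrow> L \<le> c_at n \<beta>"
    and "\<And>\<beta>. 0 < \<beta> \<Longrightarrow> \<beta> < 1 \<Longrightarrow> c_at n \<beta> \<le> h \<beta>"
    and "(h \<longlongrightarrow> L) (at_left 1)"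
  shows "c_inf n = L"
proof -
  let ?C = "{c_at n \<beta> | \<beta>. 0 < \<beta> \<and> \<beta> < 1}"
  have ev: "\<forall>\<^sub>F \<beta> in at_left 1. 0 < \<beta> \<and> \<beta> < (1::real)"
    using eventually_at_left_real[of 0 1] by simp
  have bdd: "bdd_below ?C"
    using assms(1) by (intro bdd_belowI[of _ L]) auto
  have "\<forall>\<^sub>F \<beta> in at_left 1. Inf ?C \<le> h \<beta>"
    using ev
  proof eventually_elim
    case (elim \<beta>)
    then have "Inf ?C \<le> c_at n \<beta>"
      by (intro cInf_lower bdd) auto
    also have "\<dots> \<le> h \<beta>"
      using elim assms(2) by auto
    finally show ?case .
  qed
  then have "Inf ?C \<le> L"
    by (intro tendsto_lowerbound[OF assms(3)]) auto
  moreover have "c_at n (1/2) \<in> ?C"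
    by (intro CollectI exI[of _ "1/2"]) auto
  then have "L \<le> Inf ?C"
    using assms(1) by (intro cInf_greatest) auto
  ultimately show ?thesis
    by (simp add: c_inf_def)
qed

section \<open>Degree 2\<close>

lemma complex_quadratic_splits:
  fixes Q :: "complex poly"
  assumes "degree Q = 2"
  obtains k a b where "k \<noteq> 0" "Q = smult k ([:-a, 1:] * [:-b, 1:])"
proof -
  have "\<not> constant (poly Q)"
    using assms by (simp add: constant_degree)
  then obtain a where a: "poly Q a = 0"
    using fundamental_theorem_of_algebra by blast
  then obtain R where R: "Q = [:-a, 1:] * R"
    by (auto simp: poly_eq_0_iff_dvd elim: dvdE)
  have "R \<noteq> 0"
    using assms R by auto
  then have "degree R = 1"
    using assms unfolding R by (subst (asm) degree_mult_eq) auto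
  then obtain k c where "R = [:c, k:]" "k \<noteq> 0"
    by (cases R rule: pCons_cases) (auto split: if_splits elim!: degree_eq_zeroE)
  then have "Q = smult k ([:-a, 1:] * [:-(-c/k), 1:])"
    by (simp add: R field_simps)
  with \<open>k \<noteq> 0\<close> show thesis
    by (rule that)
qed

lemma r_sup_2:
  assumes "0 < \<beta>" "\<beta> < 1"
  shows "r_sup 2 \<beta> = (1 + \<beta>) / 2"
proof (rule r_sup_eq_maximum)
  let ?P = "[:- complex_of_real \<beta>, 1:] * [:1, 1:]"
  show "?P \<in> disk_polys \<beta>"
  proof -
    have "z = \<beta> \<or> z = -1" if "poly ?P z = 0" for z
      using that by (simp only: poly_mult mult_eq_0_iff) (auto simp: add_eq_0_iff)
    then have "cmod z \<le> 1" if "poly ?P z = 0" for z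
      using that assms by fastforce
    then show ?thesis
      by (simp add: disk_polys_def)
  qed
  show "degree ?P = 2"
    by simp
  have crit: "poly (pderiv ?P) \<zeta> = 0 \<longleftrightarrow> \<zeta> = of_real ((\<beta> - 1) / 2)" for \<zeta>
    by (simp add: pderiv_pCons) (auto simp: field_simps add_eq_0_iff)
  have "crit_dist ?P \<beta> = cmod (of_real ((\<beta> - 1) / 2) - of_real \<beta>)"
    by (rule crit_dist_unique[OF crit])
  also have "\<dots> = \<bar>(\<beta> - 1) / 2 - \<beta>\<bar>"
    by (metis norm_of_real of_real_diff)
  finally show "crit_dist ?P \<beta> = (1 + \<beta>) / 2"
    using assms by (simp add: field_simps abs_if)
next
  fix P assume P: "P \<in> disk_polys \<beta>" "degree P = 2"
  obtain k a b where k: "k \<noteq> 0" "P = smult k ([:-a, 1:] * [:-b, 1:])"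
    using complex_quadratic_splits[OF P(2)] by blast
  have "poly (pderiv P) ((a + b) / 2) = 0"
    unfolding k(2) by (simp add: pderiv_smult pderiv_pCons field_simps)
  then have "crit_dist P \<beta> \<le> cmod ((a + b) / 2 - \<beta>)"
    using P by (intro crit_dist_le) auto
  also have "(a + b) / 2 - of_real \<beta> = ((a - \<beta>) + (b - \<beta>)) / 2"
    by (simp add: field_simps)
  also have "cmod \<dots> \<le> (cmod (a - \<beta>) + cmod (b - \<beta>)) / 2"
    using norm_triangle_ineq[of "a - \<beta>" "b - \<beta>"] unfolding norm_divide by simp
  also have "\<dots> \<le> (1 + \<beta>) / 2"
  proof -
    \<comment> \<open>One of the two roots is \<open>\<beta>\<close>, so one of the two summands vanishes.\<close>
    have roots: "poly P z = 0 \<longleftrightarrow> z = a \<or> z = b" for z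
      unfolding k(2) poly_smult poly_mult using k(1) by (auto simp: add_eq_0_iff)
    have "cmod a \<le> 1" "cmod b \<le> 1" "a = \<beta> \<or> b = \<beta>"
      using P(1) by (auto simp: disk_polys_def roots)
    then show ?thesis
      using norm_triangle_ineq4[of a "of_real \<beta>"] norm_triangle_ineq4[of b "of_real \<beta>"] assms
      by auto
  qed
  finally show "crit_dist P \<beta> \<le> (1 + \<beta>) / 2" .
qed

section \<open>Critical points of a cubic\<close>

text \<open>
  The hypotheses are the relations between the reciprocals \<open>A, B\<close> of the two nonzero roots of a
  cubic vanishing at \<open>0\<close> and the reciprocals \<open>p, q\<close> of its critical points. They determine
  \<open>A + B\<close> as half of \<open>p + q\<close>, and the discriminant \<open>(A - B)\<^sup>2\<close> as
  \<open>(p - q)\<^sup>2 / 3 - (p + q)\<^sup>2 / 12\<close>. Bounding the modulus of the latter by the triangle inequality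
  and applying the parallelogram law to both pairs makes all mixed terms cancel; the bound is an
  equality when \<open>p = q\<close>.
\<close>

lemma sum_recip_squares_bound:
  fixes A B p q :: complex
  assumes sum: "2 * (A + B) = p + q" and prod: "3 * (A * B) = p * q"
  shows "3 * (cmod A)\<^sup>2 + 3 * (cmod B)\<^sup>2 \<le> (cmod p)\<^sup>2 + (cmod q)\<^sup>2"
proof -
  have par: "2 * (cmod x)\<^sup>2 + 2 * (cmod y)\<^sup>2 = (cmod (x + y))\<^sup>2 + (cmod (x - y))\<^sup>2" for x y
    unfolding cmod_power2 by (simp add: power2_eq_square algebra_simps)
  have "12 * (A - B)^2 = 3 * (2 * (A + B))^2 - 16 * (3 * (A * B))"
    by algebra
  also have "\<dots> = 4 * (p - q)^2 - (p + q)^2"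
    unfolding sum prod by algebra
  finally have "12 * (cmod (A - B))\<^sup>2 = cmod (4 * (p - q)^2 - (p + q)^2)"
    by (metis norm_mult norm_numeral norm_power)
  also have "\<dots> \<le> 4 * (cmod (p - q))\<^sup>2 + (cmod (p + q))\<^sup>2"
    by (rule order_trans[OF norm_triangle_ineq4]) (simp add: norm_mult norm_power)
  finally have "12 * (cmod (A - B))\<^sup>2 \<le> 4 * (cmod (p - q))\<^sup>2 + (cmod (p + q))\<^sup>2" .
  moreover have "4 * (cmod (A + B))\<^sup>2 = (cmod (p + q))\<^sup>2"
    unfolding sum[symmetric] norm_mult power_mult_distrib by simp
  ultimately show ?thesis
    using par[of A B] par[of p q] by linarith
qed

text \<open>
  Under \<open>a \<mapsto> 1/a\<close> the disk of radius 1 around \<open>-\<beta>\<close>, which for \<open>\<bar>\<beta>\<bar> < 1\<close> contains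
  \<open>0\<close> inside, becomes the exterior of a disk. The form below keeps the squared modulus and
  the real part apart, so that the inequalities for two roots can be added.
\<close>

lemma disk_inversion:
  assumes "a \<noteq> 0" "cmod (complex_of_real \<beta> + a) \<le> 1"
  shows "1 + 2 * \<beta> * Re (1 / a) \<le> (1 - \<beta>\<^sup>2) * (cmod (1 / a))\<^sup>2"
proof -
  have "cmod (1 + \<beta> * (1 / a)) = cmod (\<beta> + a) * cmod (1 / a)"
    using assms(1) by (subst norm_mult[symmetric]) (simp add: field_simps)
  also have "\<dots> \<le> cmod (1 / a)"
    using assms(2) by (intro mult_left_le_one_le) auto
  finally have "(cmod (1 + \<beta> * (1 / a)))\<^sup>2 \<le> (cmod (1 / a))\<^sup>2"
    by (intro power_mono) auto
  moreover have "(cmod (1 + \<beta> * c))\<^sup>2 = 1 + 2 * \<beta> * Re c + \<beta>\<^sup>2 * (cmod c)\<^sup>2" for c :: complex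
    unfolding cmod_power2 by (simp add: power2_eq_square algebra_simps)
  ultimately show ?thesis
    by (simp only: left_diff_distrib)
qed

text \<open>
  This is the sharp constraint on a cubic with roots \<open>\<beta>\<close>, \<open>\<beta> + a\<close>, \<open>\<beta> + b\<close> and critical points
  \<open>\<beta> + w\<^sub>1\<close>, \<open>\<beta> + w\<^sub>2\<close>. Critical points far from \<open>\<beta>\<close> have small reciprocals, hence by
  \<open>sum_recip_squares_bound\<close> so do the roots, whereas roots in the unit disk must have large ones.
\<close>

lemma cubic_crit_points_bound:
  fixes a b w1 w2 :: complex
  assumes \<beta>: "0 \<le> \<beta>" "\<beta> \<le> 1"
    and disk: "cmod (complex_of_real \<beta> + a) \<le> 1" "cmod (complex_of_real \<beta> + b) \<le> 1"
    and crit: "3 * (w1 + w2) = 2 * (a + b)" "3 * (w1 * w2) = a * b"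
    and d: "0 \<le> d" "d \<le> cmod w1" "d \<le> cmod w2"
  shows "3 * d\<^sup>2 \<le> 1 - \<beta>\<^sup>2 + 3 * \<beta> * d"
proof (cases "d = 0")
  case True
  then show ?thesis using \<beta> by (simp add: power_le_one)
next
  case False
  then have "d > 0" and nz: "w1 \<noteq> 0" "w2 \<noteq> 0" using d by auto
  then have nz': "a \<noteq> 0" "b \<noteq> 0" using crit(2) by auto
  have sum: "2 * (1 / a + 1 / b) = 1 / w1 + 1 / w2"
  proof -
    have "2 * (1 / a + 1 / b) = 2 * (a + b) / (a * b)"
      using nz' by (simp add: field_simps)
    also have "\<dots> = 1 / w1 + 1 / w2"
      unfolding crit[symmetric] using nz by (simp add: field_simps)
    finally show ?thesis .
  qed
  have prod: "3 * ((1 / a) * (1 / b)) = (1 / w1) * (1 / w2)"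
    using crit(2) nz nz' by (simp add: field_simps)
  have inv: "cmod (1 / w1) \<le> 1 / d" "cmod (1 / w2) \<le> 1 / d"
    using d \<open>d > 0\<close> by (auto simp: norm_divide intro!: frac_le)
  have sq: "(cmod (1 / w1))\<^sup>2 \<le> (1 / d)\<^sup>2" "(cmod (1 / w2))\<^sup>2 \<le> (1 / d)\<^sup>2"
    using inv by (auto intro!: power_mono simp del: norm_one)
  have "Re (2 * x) = 2 * Re x" for x
    by simp
  then have "2 * Re (1 / a) + 2 * Re (1 / b) = Re (1 / w1) + Re (1 / w2)"
    using arg_cong[OF sum, of Re] by (simp only: plus_complex.sel distrib_left)
  moreover have "- (1 / d) \<le> Re (1 / w1)" "- (1 / d) \<le> Re (1 / w2)"
    using inv abs_Re_le_cmod[of "1 / w1"] abs_Re_le_cmod[of "1 / w2"] by linarith+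
  ultimately have re: "- (1 / d) \<le> Re (1 / a) + Re (1 / b)"
    by linarith
  have norms: "(cmod (1 / a))\<^sup>2 + (cmod (1 / b))\<^sup>2 \<le> 2 / 3 * (1 / d)\<^sup>2"
    using sum_recip_squares_bound[OF sum prod] sq by linarith
  have "2 - 2 * \<beta> * (1 / d) \<le> 2 + 2 * \<beta> * (Re (1 / a) + Re (1 / b))"
    using mult_left_mono[OF re, of "2 * \<beta>"] \<beta> by simp
  also have "\<dots> \<le> (1 - \<beta>\<^sup>2) * ((cmod (1 / a))\<^sup>2 + (cmod (1 / b))\<^sup>2)"
    using disk_inversion[OF nz'(1) disk(1)] disk_inversion[OF nz'(2) disk(2)]
    by (simp only: distrib_left)
  also have "\<dots> \<le> (1 - \<beta>\<^sup>2) * (2 / 3 * (1 / d)\<^sup>2)"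
    using norms \<beta> by (intro mult_left_mono) (auto simp: power_le_one)
  finally have "(2 - 2 * \<beta> * (1 / d)) * (3 / 2 * d\<^sup>2) \<le> (1 - \<beta>\<^sup>2) * (2 / 3 * (1 / d)\<^sup>2) * (3 / 2 * d\<^sup>2)"
    by (intro mult_right_mono) auto
  also have "\<dots> = 1 - \<beta>\<^sup>2"
    using \<open>d > 0\<close> by (simp add: power_divide)
  also have "(2 - 2 * \<beta> * (1 / d)) * (3 / 2 * d\<^sup>2) = 3 * d\<^sup>2 - 3 * \<beta> * d"
    using \<open>d > 0\<close> by (simp add: field_simps power2_eq_square)
  finally show ?thesis
    by simp
qed

section \<open>The extremal radius in degree 3\<close>

text \<open>
  This is the positive root of \<open>3 d\<^sup>2 - 3 \<beta> d = 1 - \<beta>\<^sup>2\<close>, the case of equality in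
  \<open>cubic_crit_points_bound\<close>.
\<close>

definition cubic_radius :: "real \<Rightarrow> real" where
  "cubic_radius \<beta> = (\<beta> + sqrt ((4 - \<beta>\<^sup>2) / 3)) / 2"

lemma double_cubic_radius: "2 * cubic_radius \<beta> = \<beta> + sqrt ((4 - \<beta>\<^sup>2) / 3)"
  by (simp add: cubic_radius_def)

lemma cubic_radius_pos:
  assumes "0 \<le> \<beta>" "\<beta> \<le> 1" shows "cubic_radius \<beta> > 0"
proof -
  have "\<beta>\<^sup>2 \<le> 1" using assms by (simp add: power_le_one)
  then have "sqrt ((4 - \<beta>\<^sup>2) / 3) > 0" by simp
  then show ?thesis using assms double_cubic_radius[of \<beta>] by linarith
qed

lemma cubic_radius_eq:
  assumes "0 \<le> \<beta>" "\<beta> \<le> 1"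
  shows "3 * (cubic_radius \<beta>)\<^sup>2 = 1 - \<beta>\<^sup>2 + 3 * \<beta> * cubic_radius \<beta>"
proof -
  have "\<beta>\<^sup>2 \<le> 1" using assms by (simp add: power_le_one)
  moreover have "2 * cubic_radius \<beta> - \<beta> = sqrt ((4 - \<beta>\<^sup>2) / 3)"
    using double_cubic_radius[of \<beta>] by linarith
  ultimately have "(2 * cubic_radius \<beta> - \<beta>)\<^sup>2 = (4 - \<beta>\<^sup>2) / 3"
    by simp
  then show ?thesis
    by (simp add: power2_eq_square algebra_simps)
qed

text \<open>
  To the right of its vertex \<open>\<beta> / 2\<close> the quadratic \<open>3 d\<^sup>2 - 3 \<beta> d\<close> is increasing, so its value
  decides on which side of the root \<open>d\<close> lies. All estimates of the radius go through this
  criterion, which avoids the square root.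
\<close>

lemma le_cubic_radius_iff:
  assumes "\<beta> \<le> 2 * d"
  shows "d \<le> cubic_radius \<beta> \<longleftrightarrow> 3 * d\<^sup>2 \<le> 1 - \<beta>\<^sup>2 + 3 * \<beta> * d"
proof -
  have "d \<le> cubic_radius \<beta> \<longleftrightarrow> 2 * d - \<beta> \<le> sqrt ((4 - \<beta>\<^sup>2) / 3)"
    by (auto simp: cubic_radius_def)
  also have "\<dots> \<longleftrightarrow> (2 * d - \<beta>)\<^sup>2 \<le> (4 - \<beta>\<^sup>2) / 3"
    using assms by (subst real_sqrt_le_iff[of "(2 * d - \<beta>)\<^sup>2", symmetric]) simp
  also have "\<dots> \<longleftrightarrow> 3 * d\<^sup>2 \<le> 1 - \<beta>\<^sup>2 + 3 * \<beta> * d"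
    by (auto simp: power2_eq_square algebra_simps)
  finally show ?thesis .
qed

lemma cubic_crit_dist_le:
  assumes \<beta>: "0 < \<beta>" "\<beta> < 1" and P: "P \<in> disk_polys \<beta>" "degree P = 3"
  shows "crit_dist P \<beta> \<le> cubic_radius \<beta>"
proof -
  have "poly P (of_real \<beta>) = 0"
    using P by (simp add: disk_polys_def)
  then obtain Q where Q: "P = [:- of_real \<beta>, 1:] * Q"
    by (auto simp: poly_eq_0_iff_dvd elim: dvdE)
  have "Q \<noteq> 0"
    using P Q by auto
  then have "degree Q = 2"
    using P(2) unfolding Q by (subst (asm) degree_mult_eq) auto
  then obtain k u v where k: "k \<noteq> 0" "Q = smult k ([:-u, 1:] * [:-v, 1:])"
    by (rule complex_quadratic_splits)
  have "degree (pderiv P) = 2"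
    using P by (simp add: degree_pderiv)
  then obtain l p q where l: "l \<noteq> 0" "pderiv P = smult l ([:-p, 1:] * [:-q, 1:])"
    by (rule complex_quadratic_splits)
  have "poly P u = 0" "poly P v = 0"
    unfolding Q k(2) poly_mult poly_smult by simp_all
  then have uv: "cmod u \<le> 1" "cmod v \<le> 1"
    using P(1) by (auto simp: disk_polys_def)
  have pq: "poly (pderiv P) p = 0" "poly (pderiv P) q = 0"
    unfolding l(2) poly_mult poly_smult by simp_all
  \<comment> \<open>Comparing the two factorizations of the derivative coefficientwise expresses the symmetric
    functions of the critical points \<open>p, q\<close> by those of the roots.\<close>
  have "smult l ([:-p, 1:] * [:-q, 1:]) =
        pderiv ([:- of_real \<beta>, 1:] * smult k ([:-u, 1:] * [:-v, 1:]))"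
    using l(2) Q k(2) by simp
  then have coeffs: "l = 3 * k" "l * (p + q) = 2 * k * (\<beta> + u + v)"
      "l * (p * q) = k * (\<beta> * u + \<beta> * v + u * v)"
    by (auto simp: pderiv_pCons pderiv_mult pderiv_smult algebra_simps)
  have "k * (3 * (p + q)) = k * (2 * (\<beta> + u + v))" "k * (3 * (p * q)) = k * (\<beta> * u + \<beta> * v + u * v)"
    using coeffs by (simp_all add: mult_ac)
  then have vieta: "3 * (p + q) = 2 * (\<beta> + u + v)" "3 * (p * q) = \<beta> * u + \<beta> * v + u * v"
    using k(1) by simp_all
  let ?d = "crit_dist P \<beta>"
  have d: "?d \<le> cmod (p - \<beta>)" "?d \<le> cmod (q - \<beta>)"
    using pq P(2) by (auto intro!: crit_dist_le)
  \<comment> \<open>A distance below \<open>\<beta> / 2\<close>, the vertex of the quadratic, is trivially at most the radius.\<close>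
  show ?thesis
  proof (cases "\<beta> \<le> 2 * ?d")
    case True
    have "3 * ?d\<^sup>2 \<le> 1 - \<beta>\<^sup>2 + 3 * \<beta> * ?d"
    proof (rule cubic_crit_points_bound[where a = "u - \<beta>" and b = "v - \<beta>"
          and ?w1.0 = "p - \<beta>" and ?w2.0 = "q - \<beta>"])
      show "3 * ((p - \<beta>) + (q - \<beta>)) = 2 * ((u - \<beta>) + (v - \<beta>))"
        using vieta(1) by algebra
      show "3 * ((p - \<beta>) * (q - \<beta>)) = (u - \<beta>) * (v - \<beta>)"
        using vieta by algebra
    qed (use \<beta> uv d True in auto)
    then show ?thesis
      using \<beta> True by (subst le_cubic_radius_iff) auto
  next
    case False
    have "0 \<le> sqrt ((4 - \<beta>\<^sup>2) / 3)"
      using \<beta> power_le_one[of \<beta> 2] by simp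
    with False show ?thesis
      using double_cubic_radius[of \<beta>] by linarith
  qed
qed

text \<open>
  The extremal cubic has a double critical point at \<open>\<beta> - d\<close>. Its roots are \<open>\<beta> - d + d \<omega>\<close> for the
  cube roots of unity \<open>\<omega>\<close>; for \<open>\<omega> \<noteq> 1\<close> the squared modulus is \<open>\<beta>\<^sup>2 - 3 \<beta> d + 3 d\<^sup>2\<close>, and the equation
  defining \<open>d\<close> says that this is 1.
\<close>

lemma cubic_extremal:
  assumes \<beta>: "0 < \<beta>" "\<beta> < 1"
  defines "d \<equiv> cubic_radius \<beta>"
  defines "P \<equiv> [:complex_of_real (d - \<beta>), 1:] ^ 3 - [:complex_of_real d ^ 3:]"
  shows "P \<in> disk_polys \<beta>" "degree P = 3" "crit_dist P \<beta> = d"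
proof -
  have d: "d > 0" "3 * d\<^sup>2 = 1 - \<beta>\<^sup>2 + 3 * \<beta> * d"
    using cubic_radius_pos[of \<beta>] cubic_radius_eq[of \<beta>] \<beta> by (auto simp: d_def)
  show deg: "degree P = 3"
    by (simp add: P_def power3_eq_cube)
  have crit: "poly (pderiv P) \<zeta> = 0 \<longleftrightarrow> \<zeta> = of_real (\<beta> - d)" for \<zeta>
  proof -
    have "poly (pderiv P) \<zeta> = 3 * (\<zeta> + d - \<beta>)\<^sup>2"
      by (simp add: P_def pderiv_diff pderiv_power pderiv_pCons power2_eq_square algebra_simps)
    then show ?thesis
      by (auto simp: algebra_simps eq_diff_eq)
  qed
  have "crit_dist P \<beta> = cmod (of_real (\<beta> - d) - of_real \<beta>)"
    by (rule crit_dist_unique[OF crit])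
  also have "\<dots> = d"
    using d by simp
  finally show "crit_dist P \<beta> = d" .
  have "cmod z \<le> 1" if "poly P z = 0" for z
  proof -
    define x where "x = z - \<beta> + d"
    have "x ^ 3 - d ^ 3 = 0"
      using that by (simp add: P_def x_def algebra_simps)
    moreover have "x ^ 3 - d ^ 3 = (x - d) * (x\<^sup>2 + d * x + d\<^sup>2)"
      by (simp add: power2_eq_square power3_eq_cube algebra_simps)
    ultimately consider "x = d" | "x\<^sup>2 + d * x + d\<^sup>2 = 0"
      by auto
    then show ?thesis
    proof cases
      case 1
      then show ?thesis using \<beta> by (simp add: x_def)
    next
      case 2
      \<comment> \<open>Here \<open>x\<close> is \<open>d\<close> times a primitive cube root of unity, so its real part is \<open>-d / 2\<close>.\<close>
      have re: "(Re x)\<^sup>2 - (Im x)\<^sup>2 + d * Re x + d\<^sup>2 = 0"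
        using arg_cong[OF 2, of Re] by (simp add: power2_eq_square)
      have "Im x * (2 * Re x + d) = 0"
        using arg_cong[OF 2, of Im] by (simp add: power2_eq_square algebra_simps)
      moreover have "Im x \<noteq> 0"
      proof
        assume "Im x = 0"
        then have "(Re x + d / 2)\<^sup>2 + 3 / 4 * d\<^sup>2 = 0"
          using re by (simp add: power2_eq_square algebra_simps)
        moreover have "(Re x + d / 2)\<^sup>2 + 3 / 4 * d\<^sup>2 > 0"
          using d(1) by (intro add_nonneg_pos) auto
        ultimately show False by simp
      qed
      ultimately have x: "Re x = - d / 2"
        by auto
      have "z = x + of_real (\<beta> - d)"
        by (simp add: x_def)
      then have "(cmod z)\<^sup>2 = (Re x + \<beta> - d)\<^sup>2 + (Im x)\<^sup>2"
        by (simp add: cmod_power2 add_diff_eq)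
      also have "\<dots> = 3 * d\<^sup>2 - 3 * \<beta> * d + \<beta>\<^sup>2"
        using re unfolding x by (simp add: power2_eq_square field_simps)
      also have "\<dots> = 1"
        using d(2) by simp
      finally show ?thesis
        by (auto simp: power2_eq_1_iff)
    qed
  qed
  then show "P \<in> disk_polys \<beta>"
    using deg by (auto simp: disk_polys_def P_def)
qed

lemma r_sup_3:
  assumes "0 < \<beta>" "\<beta> < 1"
  shows "r_sup 3 \<beta> = cubic_radius \<beta>"
  using cubic_extremal[OF assms] cubic_crit_dist_le[OF assms] by (rule r_sup_eq_maximum)

section \<open>The quotients in degrees 2 and 3\<close>

text \<open>
  The two estimates below have the same first-order term \<open>(1 - \<beta>) / 3\<close> at \<open>\<beta> = 1\<close>. The upper one
  says \<open>c\<^sub>3(\<beta>) \<ge> 1/3\<close>; the lower one gives \<open>c\<^sub>3(\<beta>) \<le> (2 - \<beta>) / (3 \<beta>)\<close>.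
\<close>

lemma cubic_radius_upper:
  assumes \<beta>: "0 < \<beta>" "\<beta> < 1"
  shows "cubic_radius \<beta> \<le> 1 - \<beta> * (1 - \<beta>) / 3"
proof (rule ccontr)
  let ?r = "1 - \<beta> * (1 - \<beta>) / 3"
  assume neg: "\<not> ?thesis"
  have "3 * ?r\<^sup>2 - (1 - \<beta>\<^sup>2 + 3 * \<beta> * ?r) = (1 - \<beta>)\<^sup>2 * (6 - 3 * \<beta> + \<beta>\<^sup>2) / 3"
    by (simp add: power2_eq_square field_simps)
  also have "\<dots> > 0"
    using \<beta> by (intro divide_pos_pos mult_pos_pos add_pos_nonneg) auto
  finally have "1 - \<beta>\<^sup>2 + 3 * \<beta> * ?r < 3 * ?r\<^sup>2" by simp
  moreover have "\<beta> \<le> 2 * ?r"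
  proof -
    have "\<beta> * (1 - \<beta>) \<le> 1 - \<beta>" using \<beta> by (intro mult_left_le_one_le) auto
    moreover have "2 * ?r = 2 - 2 / 3 * (\<beta> * (1 - \<beta>))" by (simp add: field_simps)
    ultimately show ?thesis using \<beta> by linarith
  qed
  ultimately show False
    using neg le_cubic_radius_iff[of \<beta> ?r] \<beta> by linarith
qed

lemma cubic_radius_lower:
  assumes \<beta>: "0 < \<beta>" "\<beta> < 1"
  shows "1 - (1 - \<beta>) * (2 - \<beta>) / 3 \<le> cubic_radius \<beta>"
proof -
  let ?r = "1 - (1 - \<beta>) * (2 - \<beta>) / 3"
  have "1 - \<beta>\<^sup>2 + 3 * \<beta> * ?r - 3 * ?r\<^sup>2 = (1 - \<beta>)\<^sup>2 * (1 + \<beta>) * (2 - \<beta>) / 3"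
    by (simp add: power2_eq_square field_simps)
  also have "\<dots> \<ge> 0"
    using \<beta> by auto
  finally have "3 * ?r\<^sup>2 \<le> 1 - \<beta>\<^sup>2 + 3 * \<beta> * ?r" by simp
  moreover have "\<beta> \<le> 2 * ?r"
  proof -
    have "2 * ?r - \<beta> = 2 / 3 + \<beta> * (3 - 2 * \<beta>) / 3"
      by (simp add: field_simps)
    moreover have "\<beta> * (3 - 2 * \<beta>) \<ge> 0"
      using \<beta> by simp
    ultimately show ?thesis by linarith
  qed
  ultimately show ?thesis
    using le_cubic_radius_iff[of \<beta> ?r] \<beta> by simp
qed

theorem theorem3:
  shows "c_inf 2 = 1 / 2 \<and> c_inf 3 = 1 / 3"
proof
  show "c_inf 2 = 1 / 2"
  proof (rule c_inf_eq_limit)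
    have c: "c_at 2 \<beta> = 1 / (2 * \<beta>)" if "0 < \<beta>" "\<beta> < 1" for \<beta>
      using that by (simp add: c_at_def r_sup_2 field_simps)
    show "1 / 2 \<le> c_at 2 \<beta>" "c_at 2 \<beta> \<le> 1 / (2 * \<beta>)" if "0 < \<beta>" "\<beta> < 1" for \<beta>
      using that by (auto simp: c field_simps)
    have "((\<lambda>\<beta>::real. 1 / (2 * \<beta>)) \<longlongrightarrow> 1 / (2 * 1)) (at_left 1)"
      by (intro tendsto_intros) auto
    then show "((\<lambda>\<beta>::real. 1 / (2 * \<beta>)) \<longlongrightarrow> 1 / 2) (at_left 1)"
      by simp
  qed
  show "c_inf 3 = 1 / 3"
  proof (rule c_inf_eq_limit)
    fix \<beta> :: real assume \<beta>: "0 < \<beta>" "\<beta> < 1"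
    then have pos: "0 < \<beta> * (1 - \<beta>)" by simp
    show "1 / 3 \<le> c_at 3 \<beta>"
      using cubic_radius_upper[OF \<beta>] pos
      by (simp add: c_at_def r_sup_3[OF \<beta>] pos_le_divide_eq)
    have "c_at 3 \<beta> \<le> ((1 - \<beta>) * (2 - \<beta>) / 3) / (\<beta> * (1 - \<beta>))"
      unfolding c_at_def r_sup_3[OF \<beta>]
      using cubic_radius_lower[OF \<beta>] pos by (intro divide_right_mono) auto
    also have "\<dots> = (2 - \<beta>) / (3 * \<beta>)"
      using \<beta> by (simp add: divide_simps)
    finally show "c_at 3 \<beta> \<le> (2 - \<beta>) / (3 * \<beta>)" .
  next
    have "((\<lambda>\<beta>::real. (2 - \<beta>) / (3 * \<beta>)) \<longlongrightarrow> (2 - 1) / (3 * 1)) (at_left 1)"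
      by (intro tendsto_intros) auto
    then show "((\<lambda>\<beta>::real. (2 - \<beta>) / (3 * \<beta>)) \<longlongrightarrow> 1 / 3) (at_left 1)"
      by simp
  qed
qed

end
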